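(* Let $t\ge 4$ be an integer. For every graph $G$ that does not contain $K_t$ as a minor and every positive integer $r$, we have \[ \mathrm{wcol}_r(G)\le \binom{r+t-2}{t-2}\cdot (t-3)(2r+1), \] which, for fixed $t$, is in $\mathcal{O}(r^{\,t-1})$ as $r\to\infty$.
   Context: All graphs are finite, undirected and simple. For a linear order $L$ of $V(G)$ and vertices $u,v$, $u$ is weakly $r$-reachable from $v$ with respect to $L$ if there is a path of length $\ell$, $0\le\ell\le r$, between $u$ and $v$ such that $u$ is the minimum (with respect to $L$) among the vertices of the path. Let $\mathrm{WReach}_r[G,L,v]$ be the set of vertices weakly $r$-reachable from $v$ (it contains $v$). The weak $r$-colouring number is $\mathrm{wcol}_r(G)=\min_{L}\max_{v\in V(G)}|\mathrm{WReach}_r[G,L,v]|$, the minimum over all linear orders $L$ of $V(G)$. *)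

theory Defs
  imports "HOL-Library.Landau_Symbols" "HOL-Library.Ramsey"
begin

text \<open>A graph is given by its vertex set \<open>V\<close> and its edge set \<open>E\<close>, whose elements are
  two-element subsets of \<open>V\<close>.\<close>

definition finite_simple_graph :: "'a set \<Rightarrow> 'a set set \<Rightarrow> bool" where
  "finite_simple_graph V E \<longleftrightarrow> finite V \<and> E \<subseteq> nsets V 2"

definition complete_edges :: "'a set \<Rightarrow> 'a set set" where
  "complete_edges V = nsets V 2"

text \<open>A path is the list of its pairwise distinct vertices, in order, so \<open>p\<close> has
  length (number of edges) \<open>length p - 1\<close>.\<close>

definition is_path :: "'a set \<Rightarrow> 'a set set \<Rightarrow> 'a list \<Rightarrow> bool" where
  "is_path V E p \<longleftrightarrow>
     p \<noteq> [] \<and> distinct p \<and> set p \<subseteq> V \<and> successively (\<lambda>x y. {x, y} \<in> E) p"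

definition path_between :: "'a set \<Rightarrow> 'a set set \<Rightarrow> 'a list \<Rightarrow> 'a \<Rightarrow> 'a \<Rightarrow> bool" where
  "path_between V E p u v \<longleftrightarrow> is_path V E p \<and> hd p = u \<and> last p = v"

definition connected_graph :: "'a set \<Rightarrow> 'a set set \<Rightarrow> bool" where
  "connected_graph V E \<longleftrightarrow> V \<noteq> {} \<and> (\<forall>u\<in>V. \<forall>v\<in>V. \<exists>p. path_between V E p u v)"

definition induced_edges :: "'a set set \<Rightarrow> 'a set \<Rightarrow> 'a set set" where
  "induced_edges E B = {e \<in> E. e \<subseteq> B}"

text \<open>\<open>(W, F)\<close> is a minor of \<open>(V, E)\<close> if it has a minor model: \<open>B w\<close> is the branch set of the
  vertex \<open>w\<close>, a nonempty set of vertices of \<open>(V, E)\<close> that is contracted to \<open>w\<close>.\<close>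

definition minor_of :: "'b set \<Rightarrow> 'b set set \<Rightarrow> 'a set \<Rightarrow> 'a set set \<Rightarrow> bool" where
  "minor_of W F V E \<longleftrightarrow>
     (\<exists>B :: 'b \<Rightarrow> 'a set.
        (\<forall>w\<in>W. B w \<subseteq> V \<and> connected_graph (B w) (induced_edges E (B w))) \<and>
        (\<forall>w\<in>W. \<forall>w'\<in>W. w \<noteq> w' \<longrightarrow> B w \<inter> B w' = {}) \<and>
        (\<forall>w\<in>W. \<forall>w'\<in>W. {w, w'} \<in> F \<longrightarrow> (\<exists>x\<in>B w. \<exists>y\<in>B w'. {x, y} \<in> E)))"

text \<open>A linear order is a reflexive relation \<open>L\<close> on \<open>V\<close>; \<open>(u, w) \<in> L\<close> means that
  \<open>u\<close> is less than or equal to \<open>w\<close>.\<close>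

definition weakly_reachable ::
    "nat \<Rightarrow> 'a set \<Rightarrow> 'a set set \<Rightarrow> 'a rel \<Rightarrow> 'a \<Rightarrow> 'a \<Rightarrow> bool" where
  "weakly_reachable r V E L u v \<longleftrightarrow>
     (\<exists>p. path_between V E p u v \<and> length p - 1 \<le> r \<and> (\<forall>w\<in>set p. (u, w) \<in> L))"

definition WReach :: "nat \<Rightarrow> 'a set \<Rightarrow> 'a set set \<Rightarrow> 'a rel \<Rightarrow> 'a \<Rightarrow> 'a set" where
  "WReach r V E L v = {u \<in> V. weakly_reachable r V E L u v}"

text \<open>In \<open>nat\<close>, the infimum of a nonempty set is its minimum and the supremum of a finite
  nonempty set is its maximum. The only effect of writing \<open>SUP\<close> instead of \<open>Max\<close> is
  that the graph without vertices gets the value \<open>0\<close>; see \<open>wcol_eq_Min_Max\<close>.\<close>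

definition wcol :: "nat \<Rightarrow> 'a set \<Rightarrow> 'a set set \<Rightarrow> nat" where
  "wcol r V E = (INF L \<in> {L. linear_order_on V L}. SUP v \<in> V. card (WReach r V E L v))"

lemma wcol_eq_Min_Max:
  assumes "finite V" "V \<noteq> {}"
  shows "wcol r V E =
    Min ((\<lambda>L. Max ((\<lambda>v. card (WReach r V E L v)) ` V)) ` {L. linear_order_on V L})"
proof -
  have "{L. linear_order_on V L} \<subseteq> Pow (V \<times> V)"
    by (auto simp: order_on_defs)
  then have fin: "finite {L. linear_order_on V L}"
    using assms by (meson finite_Pow_iff finite_SigmaI finite_subset)
  obtain L where "well_order_on V L"
    using well_order_on by blast
  then have "{L. linear_order_on V L} \<noteq> {}"
    by (auto simp: well_order_on_def)
  then show ?thesis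
    using fin assms by (simp add: wcol_def cInf_eq_Min cSup_eq_Max)
qed

end

theory Submission
  imports Defs
begin

text \<open>Split \<open>V\<close> greedily into connected parts. In a component \<open>C\<close> of what is left, the earlier
  parts adjacent to \<open>C\<close> are pairwise adjacent, hence together with \<open>C\<close> they form a complete
  minor and there are at most \<open>t - 2\<close> of them. The next part is a union of at most \<open>t - 3\<close>
  geodesics of \<open>C\<close> with a common root that touches all of them, so pairwise adjacency persists.
  Order the vertices by part. A ball of radius \<open>r\<close> meets a geodesic in at most \<open>2 * r + 1\<close>
  vertices, which bounds the weakly reachable vertices in each part. The number of parts
  that are reached is bounded as in graphs of treewidth \<open>t - 2\<close>: contracting the parts and
  joining each to the earlier parts adjacent to its component gives a chordal graph.\<close>

section \<open>Counting descending chains\<close>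

text \<open>Ends of chains from \<open>i\<close> with at most \<open>r\<close> steps, each from an
  index \<open>x\<close> into \<open>S x\<close>. With \<open>S\<close> the earlier parts adjacent
  to a component, a chain records the parts into which a walk descends.\<close>

fun descend :: "(nat \<Rightarrow> nat set) \<Rightarrow> nat \<Rightarrow> nat \<Rightarrow> nat set" where
  "descend S 0 i = {i}"
| "descend S (Suc r) i = insert i (\<Union>j\<in>S i. descend S r j)"

lemma descend_Suc_mono: "descend S r i \<subseteq> descend S (Suc r) i"
proof (induction r arbitrary: i)
  case (Suc r)
  then have "(\<Union>j\<in>S i. descend S r j) \<subseteq> (\<Union>j\<in>S i. descend S (Suc r) j)"
    by blast
  then show ?case
    by (metis descend.simps(2) insert_mono)
qed simp

lemma descend_mono: "r \<le> s \<Longrightarrow> descend S r i \<subseteq> descend S s i"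
  by (rule lift_Suc_mono_le[of "\<lambda>r. descend S r i"]) (rule descend_Suc_mono)

text \<open>Joining each \<open>i\<close> to the elements of \<open>S i\<close> gives a graph in
  which the smaller neighbours of every vertex form a clique: the decreasing order of the indices is
  a perfect elimination order.\<close>

definition chordal :: "(nat \<Rightarrow> nat set) \<Rightarrow> bool" where
  "chordal S \<longleftrightarrow> (\<forall>i. S i \<subseteq> {..<i}) \<and> (\<forall>i. \<forall>j\<in>S i. \<forall>j'\<in>S i. j < j' \<longrightarrow> j \<in> S j')"

lemma finite_chordal: "chordal S \<Longrightarrow> finite (S i)"
  unfolding chordal_def by (meson finite_lessThan finite_subset)

lemma finite_descend: "chordal S \<Longrightarrow> finite (descend S r i)"
  by (induction r arbitrary: i) (auto simp: finite_chordal)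

text \<open>Sets without \<open>m\<close> become empty because they may have no element to give up,
  and the size bound has to drop by one for every \<open>i\<close>.\<close>

definition elems_above :: "(nat \<Rightarrow> nat set) \<Rightarrow> nat \<Rightarrow> nat \<Rightarrow> nat set" where
  "elems_above S m i = (if m \<in> S i then {j \<in> S i. m < j} else {})"

lemma chordal_above:
  assumes "chordal S"
  shows "chordal (elems_above S m)"
  unfolding chordal_def
proof (intro conjI allI ballI impI)
  fix i j j' assume j: "j \<in> elems_above S m i" "j' \<in> elems_above S m i" "j < j'"
  then have *: "m \<in> S i" "j \<in> S i" "j' \<in> S i" "m < j" "m < j'"
    by (auto simp: elems_above_def split: if_splits)
  then have "m \<in> S j'" "j \<in> S j'"
    using assms j(3) unfolding chordal_def by blast+
  then show "j \<in> elems_above S m j'"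
    using * by (simp add: elems_above_def)
next
  fix i
  have "elems_above S m i \<subseteq> S i"
    by (auto simp: elems_above_def)
  then show "elems_above S m i \<subseteq> {..<i}"
    using assms unfolding chordal_def by blast
qed

lemma card_above:
  assumes "chordal S" "card (S i) \<le> Suc k"
  shows "card (elems_above S m i) \<le> k"
proof (cases "m \<in> S i")
  case True
  have "card {j \<in> S i. m < j} \<le> card (S i - {m})"
    by (intro card_mono) (auto simp: finite_chordal assms)
  also have "\<dots> \<le> k"
    using True assms by (simp add: finite_chordal)
  finally show ?thesis
    using True by (simp add: elems_above_def)
qed (simp add: elems_above_def)

text \<open>As long as a chain stays above \<open>m\<close>, chordality keeps \<open>m\<close> in
  the current set. Its first element \<open>y \<le> m\<close> is \<open>m\<close> or lies in
  \<open>S m\<close>, so the rest of the chain can start from \<open>m\<close> within the same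
  number of steps.\<close>

lemma descend_above_or:
  assumes "chordal S" "m \<in> S x" "u \<in> descend S r x"
  shows "u \<in> descend (elems_above S m) r x \<or> u \<in> descend S r m"
  using assms(2,3)
proof (induction r arbitrary: x)
  case (Suc r)
  show ?case
  proof (cases "u = x")
    case False
    then obtain y where y: "y \<in> S x" "u \<in> descend S r y"
      using Suc.prems by auto
    consider "y = m" | "y < m" | "m < y"
      by linarith
    then show ?thesis
    proof cases
      case 1
      then show ?thesis
        using y descend_Suc_mono by blast
    next
      case 2
      then have "y \<in> S m"
        using assms(1) y Suc.prems unfolding chordal_def by blast
      then show ?thesis
        using y by auto
    next
      case 3
      then have "m \<in> S y"
        using assms(1) y Suc.prems unfolding chordal_def by blast
      then consider "u \<in> descend (elems_above S m) r y" | "u \<in> descend S r m"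
        using Suc.IH y by blast
      then show ?thesis
      proof cases
        case 1
        moreover have "y \<in> elems_above S m x"
          using 3 y Suc.prems by (simp add: elems_above_def)
        ultimately show ?thesis
          by auto
      next
        case 2
        then show ?thesis
          using descend_Suc_mono by blast
      qed
    qed
  qed simp
qed simp

text \<open>Pascal's rule: with \<open>m\<close> the least element of \<open>S i\<close>, a chain from \<open>i\<close> that ends at or
  below \<open>m\<close> may as well step to \<open>m\<close> at once, and \<open>m\<close> belongs to \<open>S x\<close> for every \<open>x\<close> on a chain
  that stays above \<open>m\<close>, so there one fewer element is available.\<close>

lemma card_descend:
  assumes "chordal S" "\<And>i. card (S i) \<le> k"
  shows "card (descend S r i) \<le> (r + k) choose k"
  using assms
proof (induction "r + k" arbitrary: r k S i rule: less_induct)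
  case less
  show ?case
  proof (cases "r = 0 \<or> S i = {}")
    case True
    then have "descend S r i = {i}"
      by (cases r) auto
    then show ?thesis
      by (simp add: Suc_le_eq)
  next
    case False
    then obtain r' where r: "r = Suc r'"
      by (cases r) auto
    have fin: "finite (S i)"
      by (simp add: finite_chordal less.prems)
    have "k \<noteq> 0"
      using False fin less.prems(2)[of i] by auto
    then obtain k' where k: "k = Suc k'"
      by (cases k) auto
    define m where "m = Min (S i)"
    have m: "m \<in> S i" "\<And>y. y \<in> S i \<Longrightarrow> m \<le> y"
      using False fin by (auto simp: m_def)
    \<comment> \<open>If a chain steps first to \<open>y\<close> and gets to \<open>m\<close> or
      below, it can be replaced by one that steps to \<open>m\<close> at once. Either first step
      costs one, which leaves \<open>r'\<close>.\<close>
    have "descend S r i \<subseteq> descend (elems_above S m) r i \<union> descend S r' m"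
    proof
      fix u assume u: "u \<in> descend S r i"
      show "u \<in> descend (elems_above S m) r i \<union> descend S r' m"
      proof (cases "u = i")
        case False
        then obtain y where y: "y \<in> S i" "u \<in> descend S r' y"
          using u r by auto
        show ?thesis
        proof (cases "y = m")
          case False
          then have "m < y"
            using m y by (simp add: order_le_neq_trans)
          then have "m \<in> S y"
            using m y less.prems(1) unfolding chordal_def by blast
          have "y \<in> elems_above S m i"
            using \<open>m < y\<close> m y by (simp add: elems_above_def)
          then show ?thesis
            using descend_above_or[OF less.prems(1) \<open>m \<in> S y\<close> y(2)] r by auto
        qed (use y in simp)
      qed (simp add: r)
    qed
    then have "card (descend S r i) \<le> card (descend (elems_above S m) r i \<union> descend S r' m)"
      by (intro card_mono) (auto simp: finite_descend chordal_above less.prems)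
    also have "\<dots> \<le> card (descend (elems_above S m) r i) + card (descend S r' m)"
      by (rule card_Un_le)
    also have "card (descend (elems_above S m) r i) \<le> (r + k') choose k'"
      using less.prems k by (intro less.hyps) (auto intro: chordal_above card_above)
    also have "card (descend S r' m) \<le> (r' + k) choose k"
      using less.prems r by (intro less.hyps) auto
    also have "((r + k') choose k') + ((r' + k) choose k) = (r + k) choose k"
      by (simp add: r k)
    finally show ?thesis
      by simp
  qed
qed

section \<open>Walks and distances\<close>

text \<open>As a relation, so that walks of length \<open>n\<close> inside \<open>U\<close> are
  powers \<open>^^ n\<close> and connectivity inside \<open>U\<close> is the reflexive transitive
  closure.\<close>

definition adj :: "'a set set \<Rightarrow> 'a set \<Rightarrow> 'a rel" where
  "adj E U = {(a, b). a \<in> U \<and> b \<in> U \<and> {a, b} \<in> E}"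

lemma sym_adj: "sym (adj E U)"
  by (auto simp: sym_def adj_def insert_commute)

lemma adj_mono: "A \<subseteq> B \<Longrightarrow> adj E A \<subseteq> adj E B"
  by (auto simp: adj_def)

lemma rtrancl_adj_sym: "(a, b) \<in> (adj E U)\<^sup>* \<Longrightarrow> (b, a) \<in> (adj E U)\<^sup>*"
  by (meson sym_adj sym_rtrancl symD)

lemma rtrancl_adj_mono: "(a, b) \<in> (adj E A)\<^sup>* \<Longrightarrow> A \<subseteq> B \<Longrightarrow> (a, b) \<in> (adj E B)\<^sup>*"
  by (meson adj_mono rtrancl_mono subsetD)

lemma rtrancl_adj_in: "(a, b) \<in> (adj E U)\<^sup>* \<Longrightarrow> a \<in> U \<Longrightarrow> b \<in> U"
  by (induction rule: rtrancl_induct) (auto simp: adj_def)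

lemma relpow_adj_sym: "(a, b) \<in> adj E U ^^ n \<Longrightarrow> (b, a) \<in> adj E U ^^ n"
proof (induction n arbitrary: b)
  case (Suc n)
  then obtain c where "(a, c) \<in> adj E U ^^ n" "(c, b) \<in> adj E U"
    by auto
  then have "(b, c) \<in> adj E U" "(c, a) \<in> adj E U ^^ n"
    using Suc.IH by (auto simp: adj_def insert_commute)
  then show ?case
    by (rule relpow_Suc_I2)
qed simp

lemma path_relpow:
  assumes "path_between V E p u v" "set p \<subseteq> U"
  shows "(u, v) \<in> adj E U ^^ (length p - 1)"
proof -
  have "p \<noteq> []" "successively (\<lambda>x y. {x, y} \<in> E) p" "hd p = u" "last p = v"
    using assms by (auto simp: path_between_def is_path_def)
  then show ?thesis
    using assms(2)
  proof (induction p arbitrary: u)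
    case (Cons a p)
    show ?case
    proof (cases "p = []")
      case False
      then have "(hd p, v) \<in> adj E U ^^ (length p - 1)"
        using Cons by (cases p) auto
      moreover have "(u, hd p) \<in> adj E U"
        using False Cons.prems by (cases p) (auto simp: adj_def)
      ultimately have "(u, v) \<in> adj E U ^^ Suc (length p - 1)"
        by (rule relpow_Suc_I2[rotated])
      then show ?thesis
        using False by simp
    qed (use Cons in auto)
  qed simp
qed

text \<open>The path grows along the walk one vertex at a time; when the new vertex already lies on
  the path, the path is cut off there.\<close>

lemma path_of_rtrancl:
  assumes "(u, v) \<in> (adj E B)\<^sup>*" "u \<in> B"
  shows "\<exists>p. path_between B (induced_edges E B) p u v"
  using assms
proof (induction rule: rtrancl_induct)
  case base
  then have "path_between B (induced_edges E B) [u] u u"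
    by (simp add: path_between_def is_path_def)
  then show ?case ..
next
  case (step y v)
  then obtain p where p: "path_between B (induced_edges E B) p u y"
    by blast
  show ?case
  proof (cases "v \<in> set p")
    case True
    then obtain xs ys where xs: "p = xs @ v # ys"
      by (meson split_list)
    have "path_between B (induced_edges E B) (xs @ [v]) u v"
      using p unfolding xs path_between_def is_path_def
      by (cases xs) (auto simp: successively_append_iff successively_Cons hd_append split: if_splits)
    then show ?thesis ..
  next
    case False
    have "path_between B (induced_edges E B) (p @ [v]) u v"
      using p False step.hyps unfolding path_between_def is_path_def
      by (auto simp: successively_append_iff adj_def induced_edges_def)
    then show ?thesis ..
  qed
qed

lemma connected_graphI:
  assumes "z \<in> B" "\<And>y. y \<in> B \<Longrightarrow> (z, y) \<in> (adj E B)\<^sup>*"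
  shows "connected_graph B (induced_edges E B)"
  unfolding connected_graph_def
proof (intro conjI ballI)
  fix u v assume "u \<in> B" "v \<in> B"
  then have "(u, v) \<in> (adj E B)\<^sup>*"
    using assms(2) rtrancl_adj_sym by (meson rtrancl_trans)
  then show "\<exists>p. path_between B (induced_edges E B) p u v"
    using \<open>u \<in> B\<close> by (rule path_of_rtrancl)
qed (use assms in auto)

lemma connected_component:
  assumes "z \<in> U"
  shows "connected_graph {y. (z, y) \<in> (adj E U)\<^sup>*} (induced_edges E {y. (z, y) \<in> (adj E U)\<^sup>*})"
proof (rule connected_graphI[of z])
  fix y assume "y \<in> {y. (z, y) \<in> (adj E U)\<^sup>*}"
  then have "(z, y) \<in> (adj E U)\<^sup>*"
    by simp
  then show "(z, y) \<in> (adj E {y. (z, y) \<in> (adj E U)\<^sup>*})\<^sup>*"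
  proof (induction rule: rtrancl_induct)
    case (step y w)
    then have "(y, w) \<in> adj E {y. (z, y) \<in> (adj E U)\<^sup>*}"
      by (auto simp: adj_def intro: rtrancl_into_rtrancl)
    then show ?case
      using step.IH by (rule rtrancl_into_rtrancl[rotated])
  qed simp
qed simp

section \<open>Distances and geodesics\<close>

definition gdist :: "'a set set \<Rightarrow> 'a set \<Rightarrow> 'a \<Rightarrow> 'a \<Rightarrow> nat" where
  "gdist E U z x = (LEAST n. (z, x) \<in> adj E U ^^ n)"

lemma gdist_le: "(z, x) \<in> adj E U ^^ n \<Longrightarrow> gdist E U z x \<le> n"
  unfolding gdist_def by (rule Least_le)

lemma relpow_gdist: "(z, x) \<in> (adj E U)\<^sup>* \<Longrightarrow> (z, x) \<in> adj E U ^^ gdist E U z x"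
  unfolding gdist_def by (meson LeastI_ex rtrancl_power)

text \<open>Without a walk from \<open>z\<close> to \<open>x\<close> the value of
  \<open>gdist\<close> is unspecified, hence the reachability hypothesis.\<close>

lemma gdist_triangle:
  assumes "(z, x) \<in> (adj E U)\<^sup>*" "(x, y) \<in> adj E U ^^ n"
  shows "gdist E U z y \<le> gdist E U z x + n"
  using assms by (intro gdist_le) (auto simp: relpow_add dest: relpow_gdist)

text \<open>\<open>P\<close> is the vertex set of a shortest path from \<open>z\<close> to
  \<open>x\<close>. The distinct distances from \<open>z\<close> serve to count vertices of
  \<open>P\<close> in a ball; connectivity within \<open>P\<close> makes unions of such sets with a
  common root connected.\<close>

lemma geodesic:
  assumes "(z, x) \<in> (adj E U)\<^sup>*"
  obtains P where "z \<in> P" "x \<in> P" "inj_on (gdist E U z) P"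
    "\<And>y. y \<in> P \<Longrightarrow> (z, y) \<in> (adj E P)\<^sup>*" "\<And>y. y \<in> P \<Longrightarrow> (z, y) \<in> (adj E U)\<^sup>*"
proof -
  \<comment> \<open>The bound on the distances is added for the induction: the appended vertex is
    farther from \<open>z\<close> than all of \<open>P\<close>.\<close>
  have "\<exists>P. z \<in> P \<and> x \<in> P \<and> inj_on (gdist E U z) P \<and> gdist E U z ` P \<subseteq> {..gdist E U z x} \<and>
     (\<forall>y\<in>P. (z, y) \<in> (adj E P)\<^sup>* \<and> (z, y) \<in> (adj E U)\<^sup>*)"
    using assms
  proof (induction "gdist E U z x" arbitrary: x)
    case 0
    then have "x = z"
      using relpow_gdist[of z x E U] by simp
    then show ?case
      by (intro exI[of _ "{z}"]) auto
  next
    case (Suc n)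
    have "(z, x) \<in> adj E U ^^ Suc n"
      using relpow_gdist[OF Suc.prems] Suc.hyps(2) by simp
    then obtain y where y: "(z, y) \<in> adj E U ^^ n" "(y, x) \<in> adj E U"
      by auto
    have zy: "(z, y) \<in> (adj E U)\<^sup>*"
      using y(1) by (rule relpow_imp_rtrancl)
    have "gdist E U z y = n"
      using gdist_le[OF y(1)] gdist_triangle[OF zy, of x 1] y(2) Suc.hyps(2) by simp
    then obtain P where P: "z \<in> P" "y \<in> P" "inj_on (gdist E U z) P" "gdist E U z ` P \<subseteq> {..n}"
      "\<forall>y\<in>P. (z, y) \<in> (adj E P)\<^sup>* \<and> (z, y) \<in> (adj E U)\<^sup>*"
      using Suc.hyps(1)[of y] zy by auto
    have yx: "(y, x) \<in> adj E (insert x P)"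
      using y(2) P(2) by (auto simp: adj_def)
    have *: "(z, w) \<in> (adj E (insert x P))\<^sup>*" if "w \<in> P" for w
      using P(5) that rtrancl_adj_mono by (metis subset_insertI)
    show ?case
    proof (intro exI[of _ "insert x P"] conjI ballI)
      show "inj_on (gdist E U z) (insert x P)"
        using P(3,4) Suc.hyps(2) by force
      show "gdist E U z ` insert x P \<subseteq> {..gdist E U z x}"
        using P(4) Suc.hyps(2) by force
      fix w assume "w \<in> insert x P"
      then show "(z, w) \<in> (adj E (insert x P))\<^sup>*" "(z, w) \<in> (adj E U)\<^sup>*"
        using * P(2,5) yx Suc.prems by (auto intro: rtrancl_into_rtrancl)
    qed (use P in auto)
  qed
  then show ?thesis
    using that by blast
qed

text \<open>If \<open>u\<close> and \<open>v\<close> are within \<open>r\<close> steps, their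
  distances from \<open>z\<close> differ by at most \<open>r\<close>. By injectivity on
  \<open>P\<close> there are no more such \<open>u\<close> than integers in the interval; truncated
  subtraction can only shorten it.\<close>

lemma geodesic_near:
  assumes "inj_on (gdist E U z) P" "\<And>y. y \<in> P \<Longrightarrow> (z, y) \<in> (adj E U)\<^sup>*"
  shows "finite {u \<in> P. \<exists>l\<le>r. (u, v) \<in> adj E U ^^ l}" (is "finite ?A")
    and "card {u \<in> P. \<exists>l\<le>r. (u, v) \<in> adj E U ^^ l} \<le> 2 * r + 1"
proof -
  let ?d = "gdist E U z"
  have sub: "?d ` ?A \<subseteq> {?d v - r..?d v + r}"
  proof clarify
    fix u l assume u: "u \<in> P" "l \<le> r" "(u, v) \<in> adj E U ^^ l"
    then have zu: "(z, u) \<in> (adj E U)\<^sup>*"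
      using assms by blast
    then have zv: "(z, v) \<in> (adj E U)\<^sup>*"
      using relpow_imp_rtrancl[OF u(3)] by simp
    show "?d u \<in> {?d v - r..?d v + r}"
      using gdist_triangle[OF zu u(3)] gdist_triangle[OF zv relpow_adj_sym[OF u(3)]] u(2) by simp
  qed
  have inj: "inj_on ?d ?A"
    using assms(1) by (rule inj_on_subset) auto
  show "finite ?A"
    using finite_subset[OF sub] inj by (simp add: finite_image_iff)
  have "card ?A \<le> card {?d v - r..?d v + r}"
    using sub inj by (intro card_inj_on_le) auto
  also have "\<dots> \<le> 2 * r + 1"
    by simp
  finally show "card ?A \<le> 2 * r + 1" .
qed

lemma geodesics_near:
  assumes "finite F" "card F \<le> m"
    and "\<And>P. P \<in> F \<Longrightarrow> inj_on (gdist E U z) P"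
    and "\<And>P y. P \<in> F \<Longrightarrow> y \<in> P \<Longrightarrow> (z, y) \<in> (adj E U)\<^sup>*"
  shows "card {u \<in> \<Union>F. \<exists>l\<le>r. (u, v) \<in> adj E U ^^ l} \<le> m * (2 * r + 1)"
proof -
  have "{u \<in> \<Union>F. \<exists>l\<le>r. (u, v) \<in> adj E U ^^ l} = (\<Union>P\<in>F. {u \<in> P. \<exists>l\<le>r. (u, v) \<in> adj E U ^^ l})"
    by blast
  also have "card \<dots> \<le> (\<Sum>P\<in>F. card {u \<in> P. \<exists>l\<le>r. (u, v) \<in> adj E U ^^ l})"
    using assms by (intro card_UN_le)
  also have "\<dots> \<le> card F * (2 * r + 1)"
    using sum_bounded_above[of F "\<lambda>P. card {u \<in> P. \<exists>l\<le>r. (u, v) \<in> adj E U ^^ l}" "2 * r + 1"]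
      geodesic_near(2)[OF assms(3,4)] by simp
  also have "\<dots> \<le> m * (2 * r + 1)"
    using assms(2) by (intro mult_right_mono) auto
  finally show ?thesis .
qed

lemma complete_minorI:
  fixes t :: nat and B :: "'i \<Rightarrow> 'a set"
  assumes "finite I" "t \<le> card I"
    and "\<And>i. i \<in> I \<Longrightarrow> B i \<subseteq> V"
    and "\<And>i. i \<in> I \<Longrightarrow> connected_graph (B i) (induced_edges E (B i))"
    and "\<And>i j. i \<in> I \<Longrightarrow> j \<in> I \<Longrightarrow> i \<noteq> j \<Longrightarrow> B i \<inter> B j = {}"
    and "\<And>i j. i \<in> I \<Longrightarrow> j \<in> I \<Longrightarrow> i \<noteq> j \<Longrightarrow> \<exists>x\<in>B i. \<exists>y\<in>B j. {x, y} \<in> E"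
  shows "minor_of {..<t} (complete_edges {..<t}) V E"
proof -
  obtain f where f: "inj_on f {..<t}" "f ` {..<t} \<subseteq> I"
    using card_le_inj[of "{..<t}" I] assms(1,2) by auto
  then have *: "f w \<in> I" "w \<noteq> w' \<Longrightarrow> f w \<noteq> f w'" if "w < t" "w' < t" for w w'
    using that by (auto dest: inj_onD)
  show ?thesis
    unfolding minor_of_def
  proof (intro exI[of _ "B \<circ> f"] conjI ballI impI)
    fix w w' assume w: "w \<in> {..<t}" "w' \<in> {..<t}"
    show "(B \<circ> f) w \<subseteq> V" "connected_graph ((B \<circ> f) w) (induced_edges E ((B \<circ> f) w))"
      using *(1) w assms(3,4) by auto
    show "(B \<circ> f) w \<inter> (B \<circ> f) w' = {}" if "w \<noteq> w'"
      using * w assms(5) that by simp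
    show "\<exists>x\<in>(B \<circ> f) w. \<exists>y\<in>(B \<circ> f) w'. {x, y} \<in> E" if "{w, w'} \<in> complete_edges {..<t}"
    proof -
      have "w \<noteq> w'"
        using that by (auto simp: complete_edges_def nsets_def)
      then show ?thesis
        using * w assms(6) by simp
    qed
  qed
qed

section \<open>Decompositions into connected parts\<close>

text \<open>A decomposition \<open>H\<^sub>0, H\<^sub>1, \<dots>\<close> of the vertex set is encoded by the function \<open>h\<close> that maps
  each vertex to the index of its part. Parts may be empty.\<close>

definition part :: "'a set \<Rightarrow> ('a \<Rightarrow> nat) \<Rightarrow> nat \<Rightarrow> 'a set" where
  "part V h i = {v \<in> V. h v = i}"

definition later :: "'a set \<Rightarrow> ('a \<Rightarrow> nat) \<Rightarrow> nat \<Rightarrow> 'a set" where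
  "later V h i = {v \<in> V. i \<le> h v}"

text \<open>The component of \<open>z\<close> that remains after the parts below \<open>i\<close>
  are removed can be left only through these parts.\<close>

definition back_nbrs :: "'a set \<Rightarrow> 'a set set \<Rightarrow> ('a \<Rightarrow> nat) \<Rightarrow> nat \<Rightarrow> 'a \<Rightarrow> nat set" where
  "back_nbrs V E h i z =
     {j. j < i \<and> (\<exists>x\<in>part V h j. \<exists>y. (z, y) \<in> (adj E (later V h i))\<^sup>* \<and> {x, y} \<in> E)}"

text \<open>Takes the role of \<open>S\<close> in the counting of chains. The union avoids choosing
  \<open>z\<close>: for a connected part all choices agree, and an empty part gets the empty
  set.\<close>

definition back_parts :: "'a set \<Rightarrow> 'a set set \<Rightarrow> ('a \<Rightarrow> nat) \<Rightarrow> nat \<Rightarrow> nat set" where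
  "back_parts V E h i = (\<Union>z\<in>part V h i. back_nbrs V E h i z)"

definition connected_parts :: "'a set \<Rightarrow> 'a set set \<Rightarrow> ('a \<Rightarrow> nat) \<Rightarrow> nat \<Rightarrow> bool" where
  "connected_parts V E h n \<longleftrightarrow>
     (\<forall>i<n. \<forall>x\<in>part V h i. \<forall>y\<in>part V h i. (x, y) \<in> (adj E (part V h i))\<^sup>*)"

lemma part_subset_later: "part V h i \<subseteq> later V h i"
  by (auto simp: part_def later_def)

lemma later_mono: "i \<le> j \<Longrightarrow> later V h j \<subseteq> later V h i"
  by (auto simp: later_def)

lemma finite_back_nbrs: "finite (back_nbrs V E h i z)"
  by (rule finite_subset[of _ "{..<i}"]) (auto simp: back_nbrs_def)

lemma back_nbrs_cong:
  assumes "(z, z') \<in> (adj E (later V h i))\<^sup>*"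
  shows "back_nbrs V E h i z = back_nbrs V E h i z'"
proof -
  have "(z, y) \<in> (adj E (later V h i))\<^sup>* \<longleftrightarrow> (z', y) \<in> (adj E (later V h i))\<^sup>*" for y
    using assms rtrancl_adj_sym by (meson rtrancl_trans)
  then show ?thesis
    by (simp add: back_nbrs_def)
qed

lemma back_parts_eq:
  assumes "connected_parts V E h n" "i < n" "z \<in> part V h i"
  shows "back_parts V E h i = back_nbrs V E h i z"
proof -
  have "back_nbrs V E h i w = back_nbrs V E h i z" if "w \<in> part V h i" for w
    using assms that unfolding connected_parts_def
    by (intro back_nbrs_cong) (meson part_subset_later rtrancl_adj_mono)
  then have "back_parts V E h i = (\<Union>w\<in>part V h i. back_nbrs V E h i z)"
    unfolding back_parts_def by (intro SUP_cong) auto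
  then show ?thesis
    using assms(3) by auto
qed

text \<open>Let \<open>j < j'\<close> both touch the component of part \<open>i\<close>. That
  component lies in \<open>later V h j'\<close> and is joined there to part \<open>j'\<close>, so
  \<open>j\<close> touches the component of some vertex of part \<open>j'\<close>.\<close>

lemma chordal_back_parts:
  assumes "\<And>n. connected_parts V E h n"
  shows "chordal (back_parts V E h)"
  unfolding chordal_def
proof (intro conjI allI ballI impI)
  fix i j j' assume j: "j \<in> back_parts V E h i" "j' \<in> back_parts V E h i" "j < j'"
  then obtain z where z: "z \<in> part V h i"
    by (auto simp: back_parts_def)
  have "j \<in> back_nbrs V E h i z" "j' \<in> back_nbrs V E h i z"
    using j back_parts_eq[OF assms[of "Suc i"] _ z] by auto
  then obtain x y x' y' where xy: "j' < i"
      "x \<in> part V h j" "(z, y) \<in> (adj E (later V h i))\<^sup>*" "{x, y} \<in> E"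
      "x' \<in> part V h j'" "(z, y') \<in> (adj E (later V h i))\<^sup>*" "{x', y'} \<in> E"
    unfolding back_nbrs_def by blast
  have sub: "later V h i \<subseteq> later V h j'"
    using xy(1) by (intro later_mono) simp
  have "y' \<in> later V h j'"
    using subsetD[OF sub rtrancl_adj_in[OF xy(6) subsetD[OF part_subset_later z]]] .
  then have "(x', y') \<in> adj E (later V h j')"
    using xy(7) subsetD[OF part_subset_later xy(5)] by (simp add: adj_def)
  moreover have "(y', y) \<in> (adj E (later V h j'))\<^sup>*"
    using rtrancl_adj_mono[OF rtrancl_trans[OF rtrancl_adj_sym[OF xy(6)] xy(3)] sub] .
  ultimately have "(x', y) \<in> (adj E (later V h j'))\<^sup>*"
    by (rule converse_rtrancl_into_rtrancl)
  then have "j \<in> back_nbrs V E h j' x'"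
    using xy j(3) unfolding back_nbrs_def by blast
  then show "j \<in> back_parts V E h j'"
    using xy(5) by (auto simp: back_parts_def)
qed (auto simp: back_parts_def back_nbrs_def)

text \<open>Follow the walk from \<open>w\<close> back to \<open>u\<close>. While it stays in the
  component of \<open>z\<close>, the index \<open>j\<close> is kept; an edge into a part below
  \<open>j\<close> leads to an element of \<open>back_parts V E h j\<close>. Thus each step of the
  chain uses up an edge of the walk.\<close>

lemma walk_descends:
  assumes "u \<in> V" "(u, w) \<in> adj E (later V h (h u)) ^^ l"
    and "z \<in> part V h j" "(z, w) \<in> (adj E (later V h j))\<^sup>*" "h u \<le> j"
  shows "h u \<in> descend (back_parts V E h) l j"
  using assms(2-)
proof (induction l arbitrary: w z j)
  case 0
  then have "u \<in> later V h j"
    using part_subset_later rtrancl_adj_in by (metis relpow_0_E subsetD)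
  then show ?case
    using 0 by (simp add: later_def)
next
  case (Suc l)
  then obtain y where y: "(u, y) \<in> adj E (later V h (h u)) ^^ l" "(y, w) \<in> adj E (later V h (h u))"
    by auto
  have w: "w \<in> later V h j"
    using Suc.prems part_subset_later rtrancl_adj_in by (metis subsetD)
  have yV: "y \<in> V" "h u \<le> h y" "{y, w} \<in> E"
    using y(2) by (auto simp: adj_def later_def)
  show ?case
  proof (cases "j \<le> h y")
    case True
    then have "(w, y) \<in> adj E (later V h j)"
      using w yV by (auto simp: adj_def later_def insert_commute)
    then have "(z, y) \<in> (adj E (later V h j))\<^sup>*"
      using Suc.prems(3) by (rule rtrancl_into_rtrancl[rotated])
    then have "h u \<in> descend (back_parts V E h) l j"
      using Suc.IH y(1) Suc.prems by blast
    then show ?thesis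
      using descend_Suc_mono by blast
  next
    case False
    have yp: "y \<in> part V h (h y)"
      using yV by (simp add: part_def)
    then have "h y \<in> back_nbrs V E h j z"
      using False Suc.prems(3) yV(3) unfolding back_nbrs_def by auto
    then have "h y \<in> back_parts V E h j"
      using Suc.prems(2) by (auto simp: back_parts_def)
    moreover have "h u \<in> descend (back_parts V E h) l (h y)"
      using Suc.IH[OF y(1) yp] yV(2) by simp
    ultimately show ?thesis
      by auto
  qed
qed

section \<open>From a decomposition to the weak colouring number\<close>

lemma linear_order_refining:
  fixes h :: "'a \<Rightarrow> nat"
  assumes "finite V"
  obtains L where "linear_order_on V L" "\<And>u v. (u, v) \<in> L \<Longrightarrow> h u \<le> h v"
proof -
  obtain g :: "'a \<Rightarrow> nat" where g: "inj_on g V"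
    using finite_imp_inj_to_nat_seg[OF assms] by blast
  define L where "L = {(u, v). u \<in> V \<and> v \<in> V \<and> (h u < h v \<or> h u = h v \<and> g u \<le> g v)}"
  have "linear_order_on V L"
    unfolding order_on_defs L_def
    using g by (auto simp: refl_on_def trans_def antisym_def total_on_def inj_on_def)
  moreover have "\<And>u v. (u, v) \<in> L \<Longrightarrow> h u \<le> h v"
    by (auto simp: L_def)
  ultimately show ?thesis
    by (rule that)
qed

text \<open>In an order by parts, a vertex weakly reachable from \<open>v\<close> lies in a part
  where a chain from the part of \<open>v\<close> ends, and it is near \<open>v\<close> in the graph
  of that part and the later ones. Chains give the binomial coefficient, nearness the factor
  \<open>f\<close>.\<close>

lemma wcol_le_decomposition:
  assumes fin: "finite V"
    and conn: "\<And>n. connected_parts V E h n"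
    and width: "\<And>i. card (back_parts V E h i) \<le> k"
    and flat: "\<And>i v. v \<in> V \<Longrightarrow> card {u \<in> part V h i. \<exists>l\<le>r. (u, v) \<in> adj E (later V h i) ^^ l} \<le> f"
  shows "wcol r V E \<le> ((r + k) choose k) * f"
proof -
  obtain L where L: "linear_order_on V L" "\<And>u v. (u, v) \<in> L \<Longrightarrow> h u \<le> h v"
    using linear_order_refining[OF fin] by metis
  let ?S = "back_parts V E h"
  have chord: "chordal ?S"
    using conn by (rule chordal_back_parts)
  let ?near = "\<lambda>v i. {u \<in> part V h i. \<exists>l\<le>r. (u, v) \<in> adj E (later V h i) ^^ l}"
  have bound: "card (WReach r V E L v) \<le> ((r + k) choose k) * f" if v: "v \<in> V" for v
  proof -
    have "WReach r V E L v \<subseteq> (\<Union>i\<in>descend ?S r (h v). ?near v i)"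
    proof
      fix u assume "u \<in> WReach r V E L v"
      then obtain p where p: "u \<in> V" "path_between V E p u v" "length p - 1 \<le> r"
          "\<And>w. w \<in> set p \<Longrightarrow> (u, w) \<in> L"
        by (auto simp: WReach_def weakly_reachable_def)
      have pV: "set p \<subseteq> V" "v \<in> set p"
        using p(2) by (auto simp: path_between_def is_path_def)
      \<comment> \<open>Being the minimum of its path, \<open>u\<close> belongs to the earliest part
        that the path meets.\<close>
      then have "set p \<subseteq> later V h (h u)"
        using p(4) L(2) by (auto simp: later_def)
      then have walk: "(u, v) \<in> adj E (later V h (h u)) ^^ (length p - 1)"
        using p(2) path_relpow by metis
      have "h u \<in> descend ?S (length p - 1) (h v)"
        using walk_descends[OF p(1) walk, of v "h v"] v L(2) p(4) pV by (simp add: part_def)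
      then have "h u \<in> descend ?S r (h v)"
        using descend_mono[OF p(3)] by blast
      moreover have "u \<in> ?near v (h u)"
        using p(1,3) walk by (auto simp: part_def)
      ultimately show "u \<in> (\<Union>i\<in>descend ?S r (h v). ?near v i)"
        by blast
    qed
    then have "card (WReach r V E L v) \<le> card (\<Union>i\<in>descend ?S r (h v). ?near v i)"
      using fin by (intro card_mono) (auto simp: finite_descend chord part_def)
    also have "\<dots> \<le> (\<Sum>i\<in>descend ?S r (h v). card (?near v i))"
      by (intro card_UN_le) (simp add: finite_descend chord)
    also have "\<dots> \<le> card (descend ?S r (h v)) * f"
      using sum_bounded_above[of "descend ?S r (h v)" "\<lambda>i. card (?near v i)" f] flat[OF v] by simp
    also have "\<dots> \<le> ((r + k) choose k) * f"
      using card_descend[OF chord width] by (intro mult_right_mono) auto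
    finally show ?thesis .
  qed
  have "wcol r V E \<le> (SUP v\<in>V. card (WReach r V E L v))"
    unfolding wcol_def using L(1) by (intro cINF_lower) auto
  also have "\<dots> \<le> ((r + k) choose k) * f"
  \<comment> \<open>The supremum over the empty set of naturals is \<open>0\<close>, and
    \<open>cSUP_least\<close> asks for a nonempty set.\<close>
  proof (cases "V = {}")
    case False
    then show ?thesis
      using bound by (intro cSUP_least) auto
  qed simp
  finally show ?thesis .
qed

section \<open>Decomposing graphs without a complete minor\<close>

definition adjacent_back :: "'a set \<Rightarrow> 'a set set \<Rightarrow> ('a \<Rightarrow> nat) \<Rightarrow> nat \<Rightarrow> bool" where
  "adjacent_back V E h i \<longleftrightarrow>
     (\<forall>z\<in>later V h i. \<forall>j\<in>back_nbrs V E h i z. \<forall>j'\<in>back_nbrs V E h i z. j \<noteq> j' \<longrightarrow>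
        (\<exists>x\<in>part V h j. \<exists>y\<in>part V h j'. {x, y} \<in> E))"

text \<open>The component of \<open>z\<close> and the earlier parts touching it are disjoint,
  connected and pairwise adjacent, so they are the branch sets of a complete minor. The free index
  \<open>i\<close> names the component.\<close>

lemma card_back_less:
  assumes "connected_parts V E h i" "adjacent_back V E h i" "z \<in> later V h i"
    and no_minor: "\<not> minor_of {..<t} (complete_edges {..<t}) V E"
  shows "Suc (card (back_nbrs V E h i z)) < t"
proof (rule ccontr)
  assume "\<not> Suc (card (back_nbrs V E h i z)) < t"
  moreover have "i \<notin> back_nbrs V E h i z"
    by (simp add: back_nbrs_def)
  ultimately have card: "t \<le> card (insert i (back_nbrs V E h i z))"
    by (simp add: finite_back_nbrs)
  define C where "C = {y. (z, y) \<in> (adj E (later V h i))\<^sup>*}"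
  define B where "B j = (if j = i then C else part V h j)" for j
  have C: "C \<subseteq> later V h i"
    using assms(3) rtrancl_adj_in by (auto simp: C_def)
  have less: "j < i" if "j \<in> back_nbrs V E h i z" for j
    using that by (simp add: back_nbrs_def)
  have Bi: "B i = C" and Bj: "\<And>j. j \<in> back_nbrs V E h i z \<Longrightarrow> B j = part V h j"
    using less by (auto simp: B_def)
  have disj: "part V h j \<inter> C = {}" if "j \<in> back_nbrs V E h i z" for j
    using C less[OF that] by (auto simp: part_def later_def)
  have edge: "\<exists>x\<in>part V h j. \<exists>y\<in>C. {x, y} \<in> E" if "j \<in> back_nbrs V E h i z" for j
    using that by (auto simp: back_nbrs_def C_def)
  have "minor_of {..<t} (complete_edges {..<t}) V E"
  proof (rule complete_minorI[where B = B, OF _ card])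
    fix j assume j: "j \<in> insert i (back_nbrs V E h i z)"
    show "B j \<subseteq> V"
      using C by (auto simp: B_def part_def later_def)
    show "connected_graph (B j) (induced_edges E (B j))"
    proof (cases "j = i")
      case True
      then show ?thesis
        using connected_component[OF assms(3)] by (simp add: Bi C_def)
    next
      case False
      then have jb: "j \<in> back_nbrs V E h i z"
        using j by simp
      then obtain x where "x \<in> part V h j"
        using edge by blast
      then show ?thesis
        unfolding Bj[OF jb] using assms(1) less[OF jb]
        by (intro connected_graphI[of x]) (auto simp: connected_parts_def)
    qed
  next
    fix j j' assume "j \<in> insert i (back_nbrs V E h i z)" "j' \<in> insert i (back_nbrs V E h i z)" "j \<noteq> j'"
    then consider "j = i" "j' \<in> back_nbrs V E h i z" | "j' = i" "j \<in> back_nbrs V E h i z"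
      | "j \<in> back_nbrs V E h i z" "j' \<in> back_nbrs V E h i z"
      by blast
    then show "B j \<inter> B j' = {}" "\<exists>x\<in>B j. \<exists>y\<in>B j'. {x, y} \<in> E"
    proof (atomize (full), cases)
      case 1
      then show "B j \<inter> B j' = {} \<and> (\<exists>x\<in>B j. \<exists>y\<in>B j'. {x, y} \<in> E)"
        using disj edge Bi Bj by (metis Int_commute insert_commute)
    next
      case 2
      then show "B j \<inter> B j' = {} \<and> (\<exists>x\<in>B j. \<exists>y\<in>B j'. {x, y} \<in> E)"
        using disj edge Bi Bj by metis
    next
      case 3
      then have "part V h j \<inter> part V h j' = {}"
        using \<open>j \<noteq> j'\<close> by (auto simp: part_def)
      then show "B j \<inter> B j' = {} \<and> (\<exists>x\<in>B j. \<exists>y\<in>B j'. {x, y} \<in> E)"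
        using 3 assms(2,3) \<open>j \<noteq> j'\<close> by (simp add: Bj adjacent_back_def)
    qed
  qed (simp add: finite_back_nbrs)
  then show False
    using no_minor by simp
qed

text \<open>A hub for the attachment conditions \<open>Q j\<close> is a union of geodesics with a common root.
  Choosing the root such that it already satisfies one of the conditions saves one geodesic.\<close>

lemma geodesic_hub:
  assumes N: "finite N" "card N \<le> Suc m" "1 \<le> m"
    and Q: "\<And>j. j \<in> N \<Longrightarrow> \<exists>y. (z, y) \<in> (adj E U)\<^sup>* \<and> Q j y"
  obtains z0 F where "(z, z0) \<in> (adj E U)\<^sup>*" "finite F" "F \<noteq> {}" "card F \<le> m"
    "\<And>P. P \<in> F \<Longrightarrow> z0 \<in> P" "\<And>P. P \<in> F \<Longrightarrow> inj_on (gdist E U z0) P"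
    "\<And>P y. P \<in> F \<Longrightarrow> y \<in> P \<Longrightarrow> (z0, y) \<in> (adj E P)\<^sup>*"
    "\<And>P y. P \<in> F \<Longrightarrow> y \<in> P \<Longrightarrow> (z0, y) \<in> (adj E U)\<^sup>*"
    "\<And>j. j \<in> N \<Longrightarrow> \<exists>y\<in>\<Union>F. Q j y"
proof (cases "N = {}")
  case True
  show ?thesis
    by (rule that[of z "{{z}}"]) (use True N in auto)
next
  case False
  then obtain j0 where j0: "j0 \<in> N"
    by blast
  obtain g where g: "\<And>j. j \<in> N \<Longrightarrow> (z, g j) \<in> (adj E U)\<^sup>* \<and> Q j (g j)"
    using Q by metis
  define z0 where "z0 = g j0"
  have z0: "(z, z0) \<in> (adj E U)\<^sup>*" "Q j0 z0"
    using g j0 by (auto simp: z0_def)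
  have "\<exists>P. z0 \<in> P \<and> g j \<in> P \<and> inj_on (gdist E U z0) P \<and>
      (\<forall>y\<in>P. (z0, y) \<in> (adj E P)\<^sup>* \<and> (z0, y) \<in> (adj E U)\<^sup>*)" if "j \<in> N" for j
  proof -
    have "(z0, g j) \<in> (adj E U)\<^sup>*"
      using g[OF that] z0 rtrancl_adj_sym by (meson rtrancl_trans)
    then show ?thesis
      by (rule geodesic) blast
  qed
  then obtain P where P: "\<And>j. j \<in> N \<Longrightarrow> z0 \<in> P j \<and> g j \<in> P j \<and> inj_on (gdist E U z0) (P j) \<and>
      (\<forall>y\<in>P j. (z0, y) \<in> (adj E (P j))\<^sup>* \<and> (z0, y) \<in> (adj E U)\<^sup>*)"
    by metis
  show ?thesis
  proof (cases "N = {j0}")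
    case True
    show ?thesis
      \<comment> \<open>No further condition is left, but \<open>F\<close> must be nonempty: the
        one-vertex geodesic serves, and \<open>1 \<le> m\<close> permits it.\<close>
      by (rule that[of z0 "{{z0}}"]) (use True N z0 in auto)
  next
    case False
    show ?thesis
    proof (rule that[of z0 "P ` (N - {j0})"])
      have "card (P ` (N - {j0})) \<le> card (N - {j0})"
        using N by (intro card_image_le) auto
      also have "\<dots> \<le> m"
        using N j0 by simp
      finally show "card (P ` (N - {j0})) \<le> m" .
      show ne: "P ` (N - {j0}) \<noteq> {}"
        using False j0 by blast
      show "\<exists>y\<in>\<Union> (P ` (N - {j0})). Q j y" if "j \<in> N" for j
      proof (cases "j = j0")
        case True
        then show ?thesis
          using ne P z0(2) by blast
      next
        case False
        then show ?thesis
          using that P g by blast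
      qed
    qed (use N P z0 in auto)
  qed
qed

text \<open>The parts below \<open>n\<close> are chosen and \<open>later V h n\<close> is still to
  be split. Adjacency is required at \<open>n\<close> too, for the components of the rest. Of the
  geodesics only the size bound is kept, for all \<open>r\<close> at once.\<close>

definition good_decomposition ::
    "'a set \<Rightarrow> 'a set set \<Rightarrow> nat \<Rightarrow> ('a \<Rightarrow> nat) \<Rightarrow> nat \<Rightarrow> bool" where
  "good_decomposition V E m h n \<longleftrightarrow>
     connected_parts V E h n \<and> (\<forall>i\<le>n. adjacent_back V E h i) \<and>
     (\<forall>i<n. \<forall>v\<in>V. \<forall>r. card {u \<in> part V h i. \<exists>l\<le>r. (u, v) \<in> adj E (later V h i) ^^ l}
        \<le> m * (2 * r + 1))"

lemma good_decomposition_extend: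
  assumes good: "good_decomposition V E m h n"
    and z: "z \<in> later V h n" and m: "1 \<le> m"
    and no_minor: "\<not> minor_of {..<m + 3} (complete_edges {..<m + 3}) V E"
  obtains h' where "good_decomposition V E m h' (Suc n)" "later V h' (Suc n) \<subset> later V h n"
proof -
  let ?U = "later V h n"
  have "Suc (card (back_nbrs V E h n z)) < m + 3"
    using good z no_minor by (intro card_back_less) (auto simp: good_decomposition_def)
  \<comment> \<open>The \<open>m\<close> geodesics suffice for \<open>m + 1\<close> earlier parts
    because the root takes care of one.\<close>
  then have card: "card (back_nbrs V E h n z) \<le> Suc m"
    by simp
  have nbr: "\<exists>y. (z, y) \<in> (adj E ?U)\<^sup>* \<and> (\<exists>x\<in>part V h j. {x, y} \<in> E)"
    if "j \<in> back_nbrs V E h n z" for j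
    using that unfolding back_nbrs_def by blast
  obtain z0 F where F: "(z, z0) \<in> (adj E ?U)\<^sup>*" "finite F" "F \<noteq> {}" "card F \<le> m"
    "\<And>P. P \<in> F \<Longrightarrow> z0 \<in> P" "\<And>P. P \<in> F \<Longrightarrow> inj_on (gdist E ?U z0) P"
    "\<And>P y. P \<in> F \<Longrightarrow> y \<in> P \<Longrightarrow> (z0, y) \<in> (adj E P)\<^sup>*"
    "\<And>P y. P \<in> F \<Longrightarrow> y \<in> P \<Longrightarrow> (z0, y) \<in> (adj E ?U)\<^sup>*"
    "\<And>j. j \<in> back_nbrs V E h n z \<Longrightarrow> \<exists>y\<in>\<Union>F. \<exists>x\<in>part V h j. {x, y} \<in> E"
    by (rule geodesic_hub[where Q = "\<lambda>j y. \<exists>x\<in>part V h j. {x, y} \<in> E",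
          OF finite_back_nbrs card m nbr]) (assumption, rule that)
  define H where "H = \<Union>F"
  have z0: "z0 \<in> H"
    using F(3,5) by (auto simp: H_def)
  have z0H: "(z0, y) \<in> (adj E H)\<^sup>*" if "y \<in> H" for y
    using that F(7) unfolding H_def by (meson UnionE Union_upper rtrancl_adj_mono)
  have zH: "(z, y) \<in> (adj E ?U)\<^sup>*" if "y \<in> H" for y
    using that F(1,8) unfolding H_def by (meson UnionE rtrancl_trans)
  have HU: "H \<subseteq> ?U"
    using rtrancl_adj_in[OF zH z] by (rule subsetI)
  \<comment> \<open>\<open>H\<close> becomes part \<open>n\<close>, the other remaining vertices
    move to index \<open>n + 1\<close>, and the earlier parts stay.\<close>
  define h' where "h' v = (if v \<in> H then n else if v \<in> ?U then Suc n else h v)" for v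
  have part_less: "part V h' i = part V h i" if "i < n" for i
    using that HU by (auto simp: part_def h'_def later_def)
  have part_n: "part V h' n = H"
    using HU by (auto simp: part_def h'_def later_def)
  have later_le: "later V h' i = later V h i" if "i \<le> n" for i
    using that HU by (auto simp: later_def h'_def)
  have later_Suc: "later V h' (Suc n) = ?U - H"
    using HU by (auto simp: later_def h'_def)
  have back_le: "back_nbrs V E h' i = back_nbrs V E h i" if "i \<le> n" for i
    using that by (auto simp: fun_eq_iff back_nbrs_def part_less later_le)
  have "connected_parts V E h' (Suc n)"
    unfolding connected_parts_def
  proof (intro allI impI ballI)
    fix i x y assume i: "i < Suc n" and xy: "x \<in> part V h' i" "y \<in> part V h' i"
    show "(x, y) \<in> (adj E (part V h' i))\<^sup>*"
    proof (cases "i = n")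
      case True
      then show ?thesis
        using xy z0H part_n rtrancl_adj_sym by (metis rtrancl_trans)
    next
      case False
      then show ?thesis
        using i xy good part_less[of i] by (simp add: good_decomposition_def connected_parts_def)
    qed
  qed
  moreover have "adjacent_back V E h' i" if i: "i \<le> Suc n" for i
  proof (cases "i \<le> n")
    case True
    then have "adjacent_back V E h i"
      using good by (simp add: good_decomposition_def)
    moreover have "part V h' j = part V h j" if "j \<in> back_nbrs V E h i w" for j w
      using that True by (intro part_less) (simp add: back_nbrs_def)
    ultimately show ?thesis
      using True by (simp add: adjacent_back_def back_le later_le)
  next
    case False
    then have i: "i = Suc n"
      using i by simp
    \<comment> \<open>Removing \<open>H\<close> only shrinks components, so they touch no additional
      part below \<open>n\<close>.\<close>
    have old: "j \<in> back_nbrs V E h n w" if "j \<in> back_nbrs V E h' i w" "j < n" for j w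
      using that rtrancl_adj_mono[of w _ E "?U - H" ?U]
      unfolding back_nbrs_def i later_Suc by (auto simp: part_less)
    \<comment> \<open>If the component of \<open>w\<close> touches \<open>H\<close>, then before the
      removal \<open>w\<close> was in the component of \<open>z\<close>. So part \<open>j\<close>
      touches that component, and by the choice of the hub it touches \<open>H\<close>.\<close>
    have new: "\<exists>x\<in>part V h' n. \<exists>y\<in>part V h' j. {x, y} \<in> E"
      if w: "n \<in> back_nbrs V E h' i w" "j \<in> back_nbrs V E h' i w" "j < n" "w \<in> later V h' i" for j w
    proof -
      obtain x y where xy: "x \<in> H" "(w, y) \<in> (adj E (?U - H))\<^sup>*" "{x, y} \<in> E"
        using w(1) unfolding back_nbrs_def i later_Suc by (auto simp: part_n)
      have wy: "(w, y) \<in> (adj E ?U)\<^sup>*"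
        using xy(2) by (rule rtrancl_adj_mono) blast
      have "w \<in> ?U"
        using w(4) by (simp add: i later_Suc)
      then have "y \<in> ?U"
        using rtrancl_adj_in[OF wy] by simp
      then have "(x, y) \<in> adj E ?U"
        using xy HU by (auto simp: adj_def)
      then have "(z, y) \<in> (adj E ?U)\<^sup>*"
        using zH[OF xy(1)] by (rule rtrancl_into_rtrancl[rotated])
      then have "(z, w) \<in> (adj E ?U)\<^sup>*"
        using wy rtrancl_adj_sym by (meson rtrancl_trans)
      then have "j \<in> back_nbrs V E h n z"
        using old[OF w(2,3)] back_nbrs_cong by metis
      then obtain x y where "y \<in> H" "x \<in> part V h j" "{y, x} \<in> E"
        using F(9) unfolding H_def by (metis insert_commute)
      then show ?thesis
        unfolding part_n part_less[OF w(3)] by blast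
    qed
    show ?thesis
      unfolding adjacent_back_def
    proof (intro ballI impI)
      fix w j j' assume w: "w \<in> later V h' i" "j \<in> back_nbrs V E h' i w" "j' \<in> back_nbrs V E h' i w" "j \<noteq> j'"
      then have "j \<le> n" "j' \<le> n"
        by (auto simp: back_nbrs_def i)
      then consider "j = n" "j' < n" | "j' = n" "j < n" | "j < n" "j' < n"
        using w(4) by linarith
      then show "\<exists>x\<in>part V h' j. \<exists>y\<in>part V h' j'. {x, y} \<in> E"
      proof cases
        case 1
        then show ?thesis
          using new[of w j'] w by simp
      next
        case 2
        then show ?thesis
          using new[of w j] w by (metis insert_commute)
      next
        case 3
        have "w \<in> ?U" "adjacent_back V E h n"
          using w(1) good by (auto simp: i later_Suc good_decomposition_def)
        then show ?thesis
          using old[OF w(2) 3(1)] old[OF w(3) 3(2)] w(4)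
          by (simp add: adjacent_back_def part_less 3)
      qed
    qed
  qed
  moreover have "card {u \<in> part V h' i. \<exists>l\<le>r. (u, v) \<in> adj E (later V h' i) ^^ l} \<le> m * (2 * r + 1)"
    if "i < Suc n" "v \<in> V" for i v r
  proof (cases "i = n")
    case True
    then show ?thesis
      using geodesics_near[OF F(2,4,6,8), where r = r and v = v]
      by (simp add: part_n later_le H_def)
  next
    case False
    then show ?thesis
      using good that by (simp add: good_decomposition_def part_less later_le)
  qed
  ultimately have "good_decomposition V E m h' (Suc n)"
    by (simp add: good_decomposition_def)
  moreover have "later V h' (Suc n) \<subset> ?U"
    using z0 HU by (auto simp: later_Suc)
  ultimately show ?thesis
    by (rule that)
qed

text \<open>Each extension takes at least one vertex out of the rest, so finitely many exhaust
  \<open>V\<close>. The start is \<open>n = 0\<close>, where no part is chosen yet.\<close>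

lemma good_decomposition_exists:
  assumes "finite V" "1 \<le> m"
    and "\<not> minor_of {..<m + 3} (complete_edges {..<m + 3}) V E"
  obtains h n where "good_decomposition V E m h n" "later V h n = {}"
proof -
  have "\<exists>h' n'. good_decomposition V E m h' n' \<and> later V h' n' = {}"
    if "good_decomposition V E m h n" for h n
    using that
  proof (induction "card (later V h n)" arbitrary: h n rule: less_induct)
    case less
    show ?case
    proof (cases "later V h n = {}")
      case False
      then obtain h' where h': "good_decomposition V E m h' (Suc n)" "later V h' (Suc n) \<subset> later V h n"
        using good_decomposition_extend[OF less.prems _ assms(2,3)] by blast
      have "finite (later V h n)"
        using assms(1) by (simp add: later_def)
      then show ?thesis
        using less.hyps h' psubset_card_mono by blast
    qed (use less.prems in blast)
  qed
  moreover have "good_decomposition V E m (\<lambda>_. 0) 0"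
    by (simp add: good_decomposition_def connected_parts_def adjacent_back_def back_nbrs_def)
  ultimately show ?thesis
    using that by blast
qed

text \<open>With \<open>t = m + 3\<close> there are at most \<open>t - 2 = m + 1\<close> back parts,
  and each part consists of at most \<open>t - 3 = m\<close> geodesics.\<close>

lemma wcol_le_no_complete_minor:
  assumes "finite V" "1 \<le> m"
    and no_minor: "\<not> minor_of {..<m + 3} (complete_edges {..<m + 3}) V E"
  shows "wcol r V E \<le> ((r + Suc m) choose Suc m) * (m * (2 * r + 1))"
proof -
  obtain h n where h: "good_decomposition V E m h n" "later V h n = {}"
    using good_decomposition_exists[OF assms] .
  \<comment> \<open>Indices from \<open>n\<close> on carry empty parts, which extends the conditions
    on \<open>i < n\<close> to all \<open>i\<close>.\<close>
  have empty: "part V h i = {}" if "\<not> i < n" for i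
    using h(2) that by (auto simp: part_def later_def)
  have conn: "connected_parts V E h k" for k
    unfolding connected_parts_def
  proof (intro allI impI ballI)
    fix i x y assume xy: "x \<in> part V h i" "y \<in> part V h i"
    then have "i < n"
      using empty by blast
    then show "(x, y) \<in> (adj E (part V h i))\<^sup>*"
      using h(1) xy by (simp add: good_decomposition_def connected_parts_def)
  qed
  show ?thesis
  proof (rule wcol_le_decomposition[OF assms(1) conn])
    fix i
    show "card (back_parts V E h i) \<le> Suc m"
    proof (cases "part V h i = {}")
      case True
      then show ?thesis
        by (simp add: back_parts_def)
    next
      case False
      then obtain z where z: "z \<in> part V h i"
        by blast
      then have i: "i < n"
        using empty by blast
      have "Suc (card (back_nbrs V E h i z)) < m + 3"
        using h(1) i subsetD[OF part_subset_later z] no_minor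
        by (intro card_back_less conn) (auto simp: good_decomposition_def)
      then show ?thesis
        using back_parts_eq[OF conn _ z, of "Suc i"] by simp
    qed
  next
    fix i v assume "v \<in> V"
    then show "card {u \<in> part V h i. \<exists>l\<le>r. (u, v) \<in> adj E (later V h i) ^^ l} \<le> m * (2 * r + 1)"
      using h(1) empty[of i] by (cases "i < n") (auto simp: good_decomposition_def)
  qed
qed

text \<open>For \<open>r \<ge> 1\<close>, the estimates \<open>r + k \<le> Suc k * r\<close> and
  \<open>2 * r + 1 \<le> 3 * r\<close> give the constant. With \<open>k = t - 2\<close> the exponent
  is \<open>t - 1\<close>.\<close>

lemma binomial_times_linear_bigo:
  "(\<lambda>r::nat. real (((r + k) choose k) * (m * (2 * r + 1)))) \<in> O(\<lambda>r. real r ^ Suc k)"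
proof (rule bigoI[where c = "real (Suc k) ^ k * (3 * real m)"])
  show "\<forall>\<^sub>F r in sequentially. norm (real (((r + k) choose k) * (m * (2 * r + 1))))
      \<le> real (Suc k) ^ k * (3 * real m) * norm (real r ^ Suc k)"
    using eventually_ge_at_top[of 1]
  proof eventually_elim
    case (elim r)
    have "(r + k) choose k \<le> (r + k) ^ k"
      by (rule binomial_le_pow) simp
    also have "\<dots> \<le> (Suc k * r) ^ k"
      using elim by (intro power_mono) (auto simp: algebra_simps)
    finally have "((r + k) choose k) * (m * (2 * r + 1)) \<le> (Suc k * r) ^ k * (m * (3 * r))"
      using elim by (intro mult_mono) auto
    then have "real (((r + k) choose k) * (m * (2 * r + 1))) \<le> real ((Suc k * r) ^ k * (m * (3 * r)))"
      by (rule of_nat_mono)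
    also have "\<dots> = real (Suc k) ^ k * (3 * real m) * real r ^ Suc k"
      by (simp only: of_nat_mult of_nat_power power_mult_distrib of_nat_numeral power_Suc mult_ac)
    finally show ?case
      by simp
  qed
qed

theorem theorem1p4:
  fixes t :: nat
  assumes "t \<ge> 4"
  shows "(\<forall>(V :: 'a set) E. finite_simple_graph V E \<longrightarrow>
            \<not> minor_of {..<t} (complete_edges {..<t}) V E \<longrightarrow>
            (\<forall>r::nat. r \<ge> 1 \<longrightarrow>
               wcol r V E \<le> ((r + t - 2) choose (t - 2)) * ((t - 3) * (2 * r + 1)))) \<and>
         (\<lambda>r::nat. real (((r + t - 2) choose (t - 2)) * ((t - 3) * (2 * r + 1))))
           \<in> O(\<lambda>r. real r ^ (t - 1))"
proof -
  \<comment> \<open>Writing \<open>t = m + 3\<close> removes the truncated subtractions from the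
    bound.\<close>
  obtain m where t: "t = m + 3" "1 \<le> m"
    using assms by (intro that[of "t - 3"]) auto
  have *: "r + t - 2 = r + Suc m" "t - 2 = Suc m" "t - 3 = m" "t - 1 = Suc (Suc m)" for r
    using t by auto
  show ?thesis
    unfolding *
  proof (intro conjI allI impI)
    fix V :: "'a set" and E r
    assume "finite_simple_graph V E" "\<not> minor_of {..<t} (complete_edges {..<t}) V E"
    then show "wcol r V E \<le> ((r + Suc m) choose Suc m) * (m * (2 * r + 1))"
      using t by (intro wcol_le_no_complete_minor) (simp_all add: finite_simple_graph_def)
  qed (rule binomial_times_linear_bigo)
qed

end
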